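(* Let $0<\varepsilon<1$. Suppose $\Pi$ is a distribution over $\mathbb{R}^{m\times n}$ with the property that for any $A\in\mathbb{R}^{n\times d}$ and $b\in\mathbb{R}^n$ (with $n\geq d$), with $x^*=A^\dagger b$ and $x'=(SA)^\dagger Sb$, $$\Pr_{S\sim\Pi}\Big[\,\|x'-x^*\|_\infty\lesssim\frac{\varepsilon}{\sqrt d}\cdot\|A^\dagger\|_2\cdot\|Ax^*-b\|_2\,\Big]\ge\frac{9}{10}.$$ Then $m\gtrsim\min(n,d/\varepsilon^2)$.
   Context: $M^\dagger$ is the Moore–Penrose pseudoinverse; $\|M\|_2$ is the spectral norm. $f\lesssim g$ (resp. $f\gtrsim g$) means $f\le Cg$ (resp. $f\ge Cg$) for an absolute constant $C>0$; the constant in the conclusion may depend on the constant in the hypothesis. *)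

theory Defs
  imports "HOL-Probability.Probability_Measure" "Jordan_Normal_Form.Matrix"
begin

unbundle no vec_syntax
no_notation inner (infix "\<bullet>" 70)
hide_const (open) Finite_Cartesian_Product.vec Finite_Cartesian_Product.mat
  Finite_Cartesian_Product.row Finite_Cartesian_Product.column
  Finite_Cartesian_Product.transpose Determinants.det

text \<open>
  Dimensions are quantified over inside the statements below, so matrices and vectors are those of
  \<^theory>\<open>Jordan_Normal_Form.Matrix\<close>, with the dimensions given by the carriers.
\<close>

definition l2_norm_vec :: "real vec \<Rightarrow> real" where
  "l2_norm_vec v = sqrt (v \<bullet> v)"

text \<open>The inserted \<open>0\<close> only matters for the vector of dimension \<open>0\<close>.\<close>

definition linf_norm_vec :: "real vec \<Rightarrow> real" where
  "linf_norm_vec v = Max (insert 0 ((\<lambda>i. \<bar>v $ i\<bar>) ` {..<dim_vec v}))"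

definition spectral_norm :: "real mat \<Rightarrow> real" where
  "spectral_norm A =
     (SUP v \<in> {v \<in> carrier_vec (dim_col A). l2_norm_vec v \<le> 1}. l2_norm_vec (A *\<^sub>v v))"

definition is_pinv :: "real mat \<Rightarrow> real mat \<Rightarrow> bool" where
  "is_pinv A X \<longleftrightarrow> X \<in> carrier_mat (dim_col A) (dim_row A) \<and>
     A * X * A = A \<and> X * A * X = X \<and> (A * X)\<^sup>T = A * X \<and> (X * A)\<^sup>T = X * A"

definition pinv :: "real mat \<Rightarrow> real mat" where
  "pinv A = (THE X. is_pinv A X)"

lemma is_pinv_unique:
  assumes X: "is_pinv A X" and Y: "is_pinv A Y"
  shows "X = Y"
proof -
  obtain r c where A: "A \<in> carrier_mat r c" and rc: "r = dim_row A" "c = dim_col A"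
    by auto
  have Xc: "X \<in> carrier_mat c r" and Yc: "Y \<in> carrier_mat c r"
    using X Y unfolding is_pinv_def rc by auto
  have AX: "A * X \<in> carrier_mat r r" and AY: "A * Y \<in> carrier_mat r r"
    and XA: "X * A \<in> carrier_mat c c" and YA: "Y * A \<in> carrier_mat c c"
    using A Xc Yc by auto
  have X1: "A * X * A = A" and X2: "X * A * X = X" and X3: "(A * X)\<^sup>T = A * X"
    and X4: "(X * A)\<^sup>T = X * A" and Y1: "A * Y * A = A" and Y2: "Y * A * Y = Y"
    and Y3: "(A * Y)\<^sup>T = A * Y" and Y4: "(Y * A)\<^sup>T = Y * A"
    using X Y unfolding is_pinv_def by auto
  have "A * Y * (A * X) = A * X"
    using assoc_mult_mat[OF AY A Xc] Y1 by simp
  moreover have "(A * Y * (A * X))\<^sup>T = A * X * (A * Y)"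
    using transpose_mult[OF AY AX] X3 Y3 by simp
  moreover have "A * X * (A * Y) = A * Y"
    using assoc_mult_mat[OF AX A Yc] X1 by simp
  ultimately have e1: "A * X = A * Y"
    using X3 by simp
  have "X * A * (Y * A) = X * A"
    using assoc_mult_mat[OF Xc A YA] assoc_mult_mat[OF A Yc A] Y1 by simp
  moreover have "(X * A * (Y * A))\<^sup>T = Y * A * (X * A)"
    using transpose_mult[OF XA YA] X4 Y4 by simp
  moreover have "Y * A * (X * A) = Y * A"
    using assoc_mult_mat[OF Yc A XA] assoc_mult_mat[OF A Xc A] X1 by simp
  ultimately have e2: "X * A = Y * A"
    using X4 by simp
  have "X = Y * A * X"
    using X2 e2 by simp
  also have "\<dots> = Y * (A * Y)"
    using assoc_mult_mat[OF Yc A Xc] e1 by simp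
  also have "\<dots> = Y"
    using assoc_mult_mat[OF Yc A Yc] Y2 by simp
  finally show ?thesis .
qed

lemma pinv_eqI: "is_pinv A X \<Longrightarrow> pinv A = X"
  unfolding pinv_def by (blast intro: is_pinv_unique)

text \<open>The Borel \<open>\<sigma>\<close>-algebra on the real \<open>m \<times> n\<close> matrices, identified with families of entries.\<close>

definition borel_mat :: "nat \<Rightarrow> nat \<Rightarrow> real mat measure" where
  "borel_mat m n =
     vimage_algebra (carrier_mat m n) (\<lambda>A. \<lambda>ij\<in>{..<m} \<times> {..<n}. A $$ ij)
       (\<Pi>\<^sub>M ij\<in>{..<m} \<times> {..<n}. borel)"

definition mat_distribution :: "nat \<Rightarrow> nat \<Rightarrow> real mat measure \<Rightarrow> bool" where
  "mat_distribution m n P \<longleftrightarrow> prob_space P \<and> sets P = sets (borel_mat m n)"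

end

theory Submission
  imports Defs
begin

text \<open>
  The hard instances have as columns of \<open>A\<close> distinct standard basis vectors, with first column
  \<open>e\<^sub>a\<close>, and \<open>b\<close> is a random sign vector supported on \<open>k\<close> coordinates that include the
  support of \<open>A\<close>. The first entry of \<open>x'\<close> is \<open>r \<bullet> b\<close> for some \<open>r\<close> in the row space of \<open>S\<close>,
  that of \<open>x\<^sup>*\<close> is \<open>e\<^sub>a \<bullet> b\<close>, and the squared residual norm is \<open>k - d\<close>. By anticoncentration
  of sign sums, a small error for most signs forces \<open>\<parallel>r - e\<^sub>a\<parallel>\<^sup>2 \<le> 1/2\<close> as soon as
  \<open>k - d\<close> is at most a small multiple of \<open>d / \<epsilon>\<^sup>2\<close>. Averaging over the finitely many instances
  yields one \<open>S\<close> for which this happens for a constant fraction of the \<open>a < k\<close>. As the squared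
  distances of \<open>e\<^sub>0, \<dots>, e\<^bsub>k-1\<^esub>\<close> to an \<open>m\<close>-dimensional space sum up to at least \<open>k - m\<close>, this
  gives \<open>m \<ge> 3k/10\<close>.
\<close>

section \<open>Distance of unit vectors to a low-dimensional span\<close>

text \<open>Gram-Schmidt: \<open>s m\<close> minus its projection onto the family built so far is
  either zero on \<open>I\<close>, and nothing is added, or becomes the next member after
  normalisation.\<close>

lemma orthonormal_span:
  fixes s :: "nat \<Rightarrow> 'i \<Rightarrow> real"
  assumes I: "finite I"
  shows "\<exists>K u. K \<le> m \<and>
    (\<forall>j<K. \<forall>k<K. (\<Sum>i\<in>I. u j i * u k i) = (if j = k then 1 else (0::real))) \<and>
    (\<forall>l<m. \<exists>c. \<forall>i\<in>I. s l i = (\<Sum>k<K. c k * u k i))"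
proof (induction m)
  case 0
  then show ?case by auto
next
  case (Suc m)
  then obtain K u where K: "K \<le> m"
    and on: "\<And>j k. j < K \<Longrightarrow> k < K \<Longrightarrow> (\<Sum>i\<in>I. u j i * u k i) = (if j = k then 1 else (0::real))"
    and sp: "\<And>l. l < m \<Longrightarrow> \<exists>c. \<forall>i\<in>I. s l i = (\<Sum>k<K. c k * u k i)"
    by blast
  define p where "p k = (\<Sum>i\<in>I. s m i * u k i)" for k
  define t where "t i = s m i - (\<Sum>k<K. p k * u k i)" for i
  define q where "q = (\<Sum>i\<in>I. (t i)\<^sup>2)"
  have orth: "(\<Sum>i\<in>I. t i * u j i) = 0" if j: "j < K" for j
  proof -
    have "(\<Sum>i\<in>I. (\<Sum>k<K. p k * u k i) * u j i) = (\<Sum>k<K. p k * (\<Sum>i\<in>I. u k i * u j i))"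
      by (simp add: sum_distrib_right sum_distrib_left mult.assoc) (rule sum.swap)
    also have "\<dots> = p j"
      using j by (simp add: on if_distrib cong: if_cong)
    finally show ?thesis
      by (simp add: t_def left_diff_distrib sum_subtractf p_def)
  qed
  show ?case
  proof (cases "q = 0")
    case True
    then have "\<forall>i\<in>I. s m i = (\<Sum>k<K. p k * u k i)"
      using I by (simp add: q_def sum_nonneg_eq_0_iff t_def)
    with sp have "\<forall>l<Suc m. \<exists>c. \<forall>i\<in>I. s l i = (\<Sum>k<K. c k * u k i)"
      by (metis less_SucE)
    with K on show ?thesis
      by (intro exI[of _ K] exI[of _ u]) auto
  next
    case False
    then have q: "q > 0"
      using sum_nonneg[of I "\<lambda>i. (t i)\<^sup>2"] by (simp add: q_def less_le)
    define u' where "u' = u(K := (\<lambda>i. t i / sqrt q))"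
    have u'_lt: "u' k = u k" if "k < K" for k
      using that by (simp add: u'_def)
    have u'_K: "u' K = (\<lambda>i. t i / sqrt q)"
      by (simp add: u'_def)
    have "(\<Sum>i\<in>I. u' K i * u' K i) = q / (sqrt q * sqrt q)"
      by (simp add: u'_K q_def sum_divide_distrib power2_eq_square)
    then have norm_K: "(\<Sum>i\<in>I. u' K i * u' K i) = 1"
      using q by simp
    have orth_K: "(\<Sum>i\<in>I. u' K i * u' j i) = 0" if "j < K" for j
    proof -
      have "(\<Sum>i\<in>I. u' K i * u' j i) = (\<Sum>i\<in>I. t i * u j i) / sqrt q"
        by (simp add: u'_K u'_lt that sum_divide_distrib)
      then show ?thesis by (simp add: orth that)
    qed
    have "(\<Sum>i\<in>I. u' j i * u' k i) = (if j = k then 1 else 0)" if "j < Suc K" "k < Suc K" for j k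
      using that on norm_K orth_K[of j] orth_K[of k]
      by (auto simp: less_Suc_eq u'_lt mult.commute)
    moreover have "\<exists>c. \<forall>i\<in>I. s l i = (\<Sum>k<Suc K. c k * u' k i)" if "l < Suc m" for l
    proof (cases "l = m")
      case True
      have "s m i = (\<Sum>k<Suc K. (p(K := sqrt q)) k * u' k i)" for i
        using q by (simp add: u'_lt u'_K t_def)
      with True show ?thesis by blast
    next
      case False
      with that sp obtain c where "\<forall>i\<in>I. s l i = (\<Sum>k<K. c k * u k i)"
        by (meson less_SucE)
      then have "\<forall>i\<in>I. s l i = (\<Sum>k<Suc K. (c(K := 0)) k * u' k i)"
        by (simp add: u'_lt)
      then show ?thesis by blast
    qed
    ultimately show ?thesis
      using K by (intro exI[of _ "Suc K"] exI[of _ u']) auto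
  qed
qed

text \<open>For an orthonormal basis \<open>u\<close> of the span, the unit vector at
  \<open>a\<close> has squared distance \<open>1 - (\<Sum>k<K. (u k a)\<^sup>2)\<close> to it, so
  every \<open>a\<close> in \<open>J\<close> has a sum of at least \<open>1 - \<eta>\<close>. Over
  all of \<open>I\<close> these sums add up to \<open>K\<close>, the trace of the projection, and
  \<open>K \<le> m\<close>.\<close>

lemma card_unit_vectors_near_span:
  fixes s :: "nat \<Rightarrow> 'i \<Rightarrow> real"
  assumes I: "finite I" and J: "J \<subseteq> I"
    and near: "\<And>a. a \<in> J \<Longrightarrow> \<exists>g. (\<Sum>i\<in>I. ((\<Sum>l<m. g l * s l i) - of_bool (i = a))\<^sup>2) \<le> \<eta>"
  shows "(1 - \<eta>) * card J \<le> m"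
proof -
  from orthonormal_span[OF I, of m s] obtain K u where K: "K \<le> m"
    and on: "\<And>j k. j < K \<Longrightarrow> k < K \<Longrightarrow> (\<Sum>i\<in>I. u j i * u k i) = (if j = k then 1 else (0::real))"
    and sp: "\<And>l. l < m \<Longrightarrow> \<exists>c. \<forall>i\<in>I. s l i = (\<Sum>k<K. c k * u k i)"
    by blast
  from sp obtain c where c: "\<And>l i. l < m \<Longrightarrow> i \<in> I \<Longrightarrow> s l i = (\<Sum>k<K. c l k * u k i)"
    by metis
  have lev: "1 - \<eta> \<le> (\<Sum>k<K. (u k a)\<^sup>2)" if a: "a \<in> J" for a
  proof -
    from near[OF a] obtain g
      where g: "(\<Sum>i\<in>I. ((\<Sum>l<m. g l * s l i) - of_bool (i = a))\<^sup>2) \<le> \<eta>" by blast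
    define e where "e k = (\<Sum>l<m. g l * c l k)" for k
    have r: "(\<Sum>l<m. g l * s l i) = (\<Sum>k<K. e k * u k i)" if "i \<in> I" for i
    proof -
      have "(\<Sum>l<m. g l * s l i) = (\<Sum>l<m. \<Sum>k<K. g l * c l k * u k i)"
        by (intro sum.cong refl) (simp add: c that sum_distrib_left mult.assoc)
      also have "\<dots> = (\<Sum>k<K. e k * u k i)"
        by (subst sum.swap) (simp add: e_def sum_distrib_right)
      finally show ?thesis .
    qed
    \<comment> \<open>Parseval's identity for the orthonormal family \<open>u\<close>.\<close>
    have "(\<Sum>i\<in>I. (\<Sum>k<K. e k * u k i)\<^sup>2)
        = (\<Sum>i\<in>I. \<Sum>j<K. \<Sum>k<K. e j * e k * (u j i * u k i))"
      by (simp add: power2_eq_square sum_product ac_simps)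
    also have "\<dots> = (\<Sum>j<K. \<Sum>i\<in>I. \<Sum>k<K. e j * e k * (u j i * u k i))"
      by (rule sum.swap)
    also have "\<dots> = (\<Sum>j<K. \<Sum>k<K. e j * e k * (\<Sum>i\<in>I. u j i * u k i))"
      by (subst sum.swap) (simp add: sum_distrib_left)
    also have "\<dots> = (\<Sum>j<K. (e j)\<^sup>2)"
      by (simp add: on if_distrib power2_eq_square cong: if_cong)
    finally have sq: "(\<Sum>i\<in>I. (\<Sum>k<K. e k * u k i)\<^sup>2) = (\<Sum>j<K. (e j)\<^sup>2)" .
    have aI: "a \<in> I" using a J by blast
    have "(\<Sum>i\<in>I. ((\<Sum>l<m. g l * s l i) - of_bool (i = a))\<^sup>2)
        = (\<Sum>i\<in>I. (\<Sum>k<K. e k * u k i)\<^sup>2 + (if i = a then 1 - 2 * (\<Sum>k<K. e k * u k i) else 0))"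
      by (intro sum.cong refl) (simp add: r power2_eq_square algebra_simps)
    also have "\<dots> = (\<Sum>j<K. (e j)\<^sup>2) + 1 - 2 * (\<Sum>k<K. e k * u k a)"
      using aI I by (simp add: sum.distrib sq)
    \<comment> \<open>Completing the square isolates the distance to the span; the first sum
      vanishes exactly at the orthogonal projection.\<close>
    also have "\<dots> = (\<Sum>k<K. (e k - u k a)\<^sup>2) + 1 - (\<Sum>k<K. (u k a)\<^sup>2)"
      by (simp add: power2_diff sum.distrib sum_subtractf sum_distrib_left mult.assoc)
    finally show ?thesis
      using g sum_nonneg[of "{..<K}" "\<lambda>k. (e k - u k a)\<^sup>2"] by simp
  qed
  have "(1 - \<eta>) * card J = (\<Sum>a\<in>J. 1 - \<eta>)" by simp
  also have "\<dots> \<le> (\<Sum>a\<in>J. \<Sum>k<K. (u k a)\<^sup>2)"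
    by (intro sum_mono lev)
  also have "\<dots> \<le> (\<Sum>a\<in>I. \<Sum>k<K. (u k a)\<^sup>2)"
    using I J by (intro sum_mono2) (auto intro: sum_nonneg)
  also have "\<dots> = (\<Sum>k<K. \<Sum>a\<in>I. u k a * u k a)"
    by (subst sum.swap) (simp add: power2_eq_square)
  also have "\<dots> = K" by (simp add: on)
  also have "\<dots> \<le> m" using K by simp
  finally show ?thesis .
qed

section \<open>Moments and anticoncentration of sign sums\<close>

text \<open>A sign vector is encoded by the set of its positive coordinates, so that expectations
  over uniform signs on \<open>N\<close> are sums over \<open>Pow N\<close> divided by
  \<open>2 ^ card N\<close>.\<close>

definition sign_in :: "'i set \<Rightarrow> 'i \<Rightarrow> real" where
  "sign_in U i = (if i \<in> U then 1 else - 1)"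

lemma sum_Pow_insert:
  fixes f :: "'i set \<Rightarrow> real"
  assumes "finite N" "x \<notin> N"
  shows "(\<Sum>U\<in>Pow (insert x N). f U) = (\<Sum>U\<in>Pow N. f U + f (insert x U))"
proof -
  have "inj_on (insert x) (Pow N)"
    using assms(2) by (auto simp: inj_on_def)
  moreover have "Pow N \<inter> insert x ` Pow N = {}"
    using assms(2) by auto
  ultimately show ?thesis
    using assms(1) by (simp add: Pow_insert sum.union_disjoint sum.reindex sum.distrib)
qed

lemma sign_sum_insert:
  assumes "finite N" "x \<notin> N" "U \<subseteq> N"
  shows "(\<Sum>i\<in>insert x N. w i * sign_in U i) = (\<Sum>i\<in>N. w i * sign_in U i) - w x"
    and "(\<Sum>i\<in>insert x N. w i * sign_in (insert x U) i) = (\<Sum>i\<in>N. w i * sign_in U i) + w x"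
proof -
  have "(\<Sum>i\<in>N. w i * sign_in (insert x U) i) = (\<Sum>i\<in>N. w i * sign_in U i)"
    using assms(2) by (intro sum.cong) (auto simp: sign_in_def)
  moreover have "x \<notin> U" using assms by blast
  ultimately show "(\<Sum>i\<in>insert x N. w i * sign_in U i) = (\<Sum>i\<in>N. w i * sign_in U i) - w x"
    and "(\<Sum>i\<in>insert x N. w i * sign_in (insert x U) i) = (\<Sum>i\<in>N. w i * sign_in U i) + w x"
    using assms by (simp_all add: sign_in_def)
qed

text \<open>Induction on \<open>N\<close>: a new index \<open>x\<close> splits each sum
  \<open>X\<close> into \<open>X - w x\<close> and \<open>X + w x\<close>, whose odd mixed terms
  cancel. The constant \<open>\<gamma>\<close> enters the bounds like one more coefficient.\<close>

lemma sign_sum_moments: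
  fixes \<gamma> :: real
  assumes "finite N"
  shows "(\<Sum>U\<in>Pow N. (\<gamma> + (\<Sum>i\<in>N. w i * sign_in U i))\<^sup>2) = 2 ^ card N * (\<gamma>\<^sup>2 + (\<Sum>i\<in>N. (w i)\<^sup>2))"
    and "(\<Sum>U\<in>Pow N. (\<gamma> + (\<Sum>i\<in>N. w i * sign_in U i)) ^ 4)
      \<le> 3 * 2 ^ card N * (\<gamma>\<^sup>2 + (\<Sum>i\<in>N. (w i)\<^sup>2))\<^sup>2"
  using assms
proof (induction N rule: finite_induct)
  case empty
  { case 1 show ?case by simp }
  { case 2 show ?case by simp }
next
  case (insert x N)
  let ?X = "\<lambda>U. \<gamma> + (\<Sum>i\<in>N. w i * sign_in U i)"
  let ?s = "\<gamma>\<^sup>2 + (\<Sum>i\<in>N. (w i)\<^sup>2)"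
  have split: "(\<Sum>U\<in>Pow (insert x N). (\<gamma> + (\<Sum>i\<in>insert x N. w i * sign_in U i)) ^ k)
      = (\<Sum>U\<in>Pow N. (?X U - w x) ^ k + (?X U + w x) ^ k)" for k
    using insert.hyps
    by (subst sum_Pow_insert) (auto intro!: sum.cong simp del: sum.insert simp: sign_sum_insert algebra_simps)
  { case 1
    have "(\<Sum>U\<in>Pow N. (?X U - w x)\<^sup>2 + (?X U + w x)\<^sup>2) = (\<Sum>U\<in>Pow N. 2 * (?X U)\<^sup>2 + 2 * (w x)\<^sup>2)"
      by (intro sum.cong refl) (simp add: power2_eq_square algebra_simps)
    also have "\<dots> = 2 * (2 ^ card N * ?s) + 2 ^ card N * (2 * (w x)\<^sup>2)"
      using insert.hyps by (simp add: sum.distrib insert.IH(1) card_Pow flip: sum_distrib_left)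
    finally show ?case
      unfolding split using insert.hyps by (simp add: algebra_simps) }
  { case 2
    have "(\<Sum>U\<in>Pow N. (?X U - w x) ^ 4 + (?X U + w x) ^ 4)
        = (\<Sum>U\<in>Pow N. 2 * ?X U ^ 4 + 12 * (w x)\<^sup>2 * (?X U)\<^sup>2 + 2 * w x ^ 4)"
      by (intro sum.cong refl) (simp add: power4_eq_xxxx power2_eq_square algebra_simps)
    also have "\<dots> = 2 * (\<Sum>U\<in>Pow N. ?X U ^ 4) + 12 * (w x)\<^sup>2 * (2 ^ card N * ?s) + 2 ^ card N * (2 * w x ^ 4)"
      using insert.hyps by (simp add: sum.distrib card_Pow flip: sum_distrib_left insert.IH(1))
    \<comment> \<open>Raising the last coefficient from 2 to 6 makes the right-hand side a multiple
      of a perfect square.\<close>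
    also have "\<dots> \<le> 2 * (3 * 2 ^ card N * ?s\<^sup>2) + 12 * (w x)\<^sup>2 * (2 ^ card N * ?s) + 2 ^ card N * (6 * w x ^ 4)"
      by (intro add_mono mult_left_mono insert.IH(2)) auto
    also have "\<dots> = 3 * (2 * 2 ^ card N) * (?s + (w x)\<^sup>2)\<^sup>2"
      by (simp add: power4_eq_xxxx power2_eq_square distrib_left distrib_right)
    also have "\<dots> = 3 * 2 ^ card (insert x N) * (\<gamma>\<^sup>2 + (\<Sum>i\<in>insert x N. (w i)\<^sup>2))\<^sup>2"
      using insert.hyps by (simp add: algebra_simps)
    finally show ?case
      unfolding split . }
qed

text \<open>In place of Paley--Zygmund: \<open>1 - (X - 3s)\<^sup>2 / (8s\<^sup>2)\<close> is a minorant of the indicator of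
  \<open>X > s/10\<close> whose expectation is controlled by the first two moments of \<open>X\<close>.\<close>

lemma sign_sum_anticoncentration:
  fixes \<gamma> :: real
  assumes N: "finite N" and s: "s = \<gamma>\<^sup>2 + (\<Sum>i\<in>N. (w i)\<^sup>2)" and pos: "s > 0"
  shows "2 ^ card N \<le> 4 * real (card {U \<in> Pow N. (\<gamma> + (\<Sum>i\<in>N. w i * sign_in U i))\<^sup>2 > s / 10})"
proof -
  let ?X = "\<lambda>U. (\<gamma> + (\<Sum>i\<in>N. w i * sign_in U i))\<^sup>2"
  let ?B = "{U \<in> Pow N. ?X U > s / 10}"
  have pw: "8 * s\<^sup>2 - (?X U - 3 * s)\<^sup>2 \<le> 8 * s\<^sup>2 * of_bool (?X U > s / 10)" for U
  proof (cases "?X U > s / 10")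
    case False
    \<comment> \<open>The threshold \<open>s / 10\<close> works because 2.9 squared is 8.41, which
      exceeds 8: below it the minorant is not positive.\<close>
    then have "(29 / 10 * s)\<^sup>2 \<le> (3 * s - ?X U)\<^sup>2"
      using pos by (intro power_mono) auto
    moreover have "(29 / 10 * s)\<^sup>2 \<ge> 8 * s\<^sup>2"
      by (simp add: power_mult_distrib power2_eq_square)
    ultimately show ?thesis
      using False by (simp add: power2_commute)
  qed simp
  have X2: "(?X U)\<^sup>2 = (\<gamma> + (\<Sum>i\<in>N. w i * sign_in U i)) ^ 4" for U
    by simp
  \<comment> \<open>The expanded minorant is \<open>- s\<^sup>2 + 6 * s * X - X\<^sup>2\<close>. The
    moment bounds leave -1 + 6 - 3 = 2 times \<open>s\<^sup>2\<close>, and 2 / 8 is the fraction 1/4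
    of the claim.\<close>
  have "2 * s\<^sup>2 * 2 ^ card N = - s\<^sup>2 * 2 ^ card N + 6 * s * (2 ^ card N * s) - 3 * 2 ^ card N * s\<^sup>2"
    by (simp add: power2_eq_square)
  also have "\<dots> \<le> - s\<^sup>2 * 2 ^ card N + 6 * s * (\<Sum>U\<in>Pow N. ?X U) - (\<Sum>U\<in>Pow N. (?X U)\<^sup>2)"
    unfolding X2 using sign_sum_moments[OF N, of \<gamma> w] by (simp add: s)
  also have "\<dots> = (\<Sum>U\<in>Pow N. 8 * s\<^sup>2 - (?X U - 3 * s)\<^sup>2)"
  proof -
    have "8 * s\<^sup>2 - (y - 3 * s)\<^sup>2 = - s\<^sup>2 + 6 * s * y - y\<^sup>2" for y
      by (simp add: power2_eq_square algebra_simps)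
    then show ?thesis
      unfolding sum_distrib_left using N by (simp only: sum.distrib sum_subtractf) (simp add: card_Pow)
  qed
  also have "\<dots> \<le> (\<Sum>U\<in>Pow N. 8 * s\<^sup>2 * of_bool (?X U > s / 10))"
    by (intro sum_mono pw)
  also have "\<dots> = 8 * s\<^sup>2 * card ?B"
    using N by (simp add: Int_def flip: sum_distrib_left)
  finally have "2 * s\<^sup>2 * 2 ^ card N \<le> 2 * s\<^sup>2 * (4 * card ?B)"
    by simp
  then show ?thesis
    using pos by (subst (asm) mult_le_cancel_left_pos) auto
qed

section \<open>Choosing one matrix by averaging\<close>

text \<open>The expected number of events that occur is at least \<open>p * card I\<close>, so it
  cannot lie below this value everywhere.\<close>

lemma (in prob_space) exists_point_in_many_events:
  assumes I: "finite I" and p: "\<And>i. i \<in> I \<Longrightarrow> prob (E i) \<ge> p" and "p > 0"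
  shows "\<exists>x\<in>space M. p * card I \<le> card {i \<in> I. x \<in> E i}"
proof (rule ccontr)
  assume neg: "\<not> ?thesis"
  \<comment> \<open>A set outside the sigma-algebra has measure 0, so positive probability already
    yields measurability. This is how the success events, which involve \<open>pinv (S * A)\<close>,
    become measurable.\<close>
  have E: "E i \<in> events" if "i \<in> I" for i
    using p[OF that] \<open>p > 0\<close> measure_notin_sets[of "E i" M] by linarith
  let ?f = "\<lambda>x. \<Sum>i\<in>I. indicator (E i) x :: real"
  have f: "?f x = card {i \<in> I. x \<in> E i}" for x
    using I by (simp add: indicator_def Int_def)
  have int: "integrable M ?f"
    using E by (intro Bochner_Integration.integrable_sum) (simp add: emeasure_eq_measure)
  moreover have "AE x in M. ?f x < p * card I"
    using neg by (intro AE_I2) (auto simp: f not_le)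
  ultimately have "expectation ?f < p * card I"
    by (rule expectation_less)
  moreover have "expectation ?f = (\<Sum>i\<in>I. prob (E i))"
    using E by (subst Bochner_Integration.integral_sum) (auto simp: emeasure_eq_measure)
  moreover have "(\<Sum>i\<in>I. prob (E i)) \<ge> p * card I"
    using sum_bounded_below[of I p "\<lambda>i. prob (E i)"] p by (simp add: mult.commute)
  ultimately show False by simp
qed

text \<open>The constant \<open>\<gamma>\<close> is only there for a matrix without rows, whose product has a junk
  entry at index 0. It spares us the existence of the pseudoinverse of \<open>S * A\<close>.\<close>

lemma mult_mat_vec_first_affine:
  fixes M :: "real mat"
  shows "\<exists>\<gamma> g. \<forall>v\<in>carrier_vec m. (M *\<^sub>v v) $ 0 = \<gamma> + (\<Sum>l<m. g l * v $ l)"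
proof (cases "0 < dim_row M")
  case True
  then have "\<forall>v\<in>carrier_vec m. (M *\<^sub>v v) $ 0 = 0 + (\<Sum>l<m. row M 0 $ l * v $ l)"
    by (auto simp: scalar_prod_def lessThan_atLeast0)
  then show ?thesis by blast
next
  case False
  \<comment> \<open>All vectors of dimension 0 are equal, so their unspecified entry at 0 is one
    fixed number, taken as \<open>\<gamma>\<close>.\<close>
  have "vec 0 f $ 0 = vec 0 f' $ 0" for f f' :: "nat \<Rightarrow> real"
    by (metis (no_types, opaque_lifting) eq_vecI dim_vec less_nat_zero_code)
  with False have "\<forall>v\<in>carrier_vec m. (M *\<^sub>v v) $ 0 = vec 0 (\<lambda>_. 0) $ 0 + (\<Sum>l<m. 0 * v $ l)"
    by (simp add: mult_mat_vec_def)
  then show ?thesis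
    by (intro exI[of _ "vec 0 (\<lambda>_. 0) $ 0"] exI[of _ "\<lambda>_. 0"])
qed

section \<open>Matrices whose columns are standard basis vectors\<close>

definition coord_mat :: "(nat \<Rightarrow> nat) \<Rightarrow> nat \<Rightarrow> nat \<Rightarrow> real mat" where
  "coord_mat \<pi> n d = mat n d (\<lambda>(i, j). of_bool (i = \<pi> j))"

lemma coord_mat_carrier [simp]: "coord_mat \<pi> n d \<in> carrier_mat n d"
  by (simp add: coord_mat_def)

lemma l2_norm_vec_eq: "l2_norm_vec v = sqrt (\<Sum>i<dim_vec v. (v $ i)\<^sup>2)"
  by (simp add: l2_norm_vec_def scalar_prod_def power2_eq_square lessThan_atLeast0)

lemma abs_index_le_linf_norm_vec:
  assumes "i < dim_vec v"
  shows "\<bar>v $ i\<bar> \<le> linf_norm_vec v"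
  unfolding linf_norm_vec_def using assms by (intro Max_ge) auto

context
  fixes \<pi> :: "nat \<Rightarrow> nat" and n d :: nat
  assumes inj: "inj_on \<pi> {..<d}" and range: "\<And>j. j < d \<Longrightarrow> \<pi> j < n"
begin

lemma transpose_coord_mat_mult_vec:
  assumes "v \<in> carrier_vec n"
  shows "(coord_mat \<pi> n d)\<^sup>T *\<^sub>v v = vec d (\<lambda>j. v $ \<pi> j)"
  using assms range by (intro eq_vecI) (auto simp: coord_mat_def scalar_prod_def if_distrib cong: if_cong)

text \<open>The columns are orthonormal, so the transpose is a left inverse and satisfies the
  Penrose equations.\<close>

lemma pinv_coord_mat: "pinv (coord_mat \<pi> n d) = (coord_mat \<pi> n d)\<^sup>T"
proof (rule pinv_eqI)
  let ?A = "coord_mat \<pi> n d"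
  have A: "?A \<in> carrier_mat n d" and At: "?A\<^sup>T \<in> carrier_mat d n" by simp_all
  have one: "?A\<^sup>T * ?A = 1\<^sub>m d"
  proof (rule eq_matI)
    fix i j assume "i < dim_row (1\<^sub>m d :: real mat)" "j < dim_col (1\<^sub>m d :: real mat)"
    then show "(?A\<^sup>T * ?A) $$ (i, j) = 1\<^sub>m d $$ (i, j)"
      using range[of i] inj
      by (auto simp: coord_mat_def scalar_prod_def inj_on_def if_distrib cong: if_cong)
  qed (simp_all add: coord_mat_def)
  show "is_pinv ?A ?A\<^sup>T"
    unfolding is_pinv_def
    using A At one assoc_mult_mat[OF A At A] transpose_mult[OF A At] transpose_mult[OF At A]
    by (simp add: coord_mat_def)
qed

text \<open>The transpose selects distinct coordinates of a vector, which cannot increase its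
  norm.\<close>

lemma spectral_norm_pinv_coord_mat: "spectral_norm (pinv (coord_mat \<pi> n d)) \<le> 1"
  unfolding spectral_norm_def pinv_coord_mat
proof (rule cSUP_least)
  show "{v \<in> carrier_vec (dim_col (coord_mat \<pi> n d)\<^sup>T). l2_norm_vec v \<le> 1} \<noteq> {}"
    by (auto simp: l2_norm_vec_eq coord_mat_def intro!: exI[of _ "0\<^sub>v n"])
next
  fix v assume "v \<in> {v \<in> carrier_vec (dim_col (coord_mat \<pi> n d)\<^sup>T). l2_norm_vec v \<le> 1}"
  then have v: "v \<in> carrier_vec n" and le: "l2_norm_vec v \<le> 1"
    by (auto simp: coord_mat_def)
  have "(\<Sum>j<d. (v $ \<pi> j)\<^sup>2) = (\<Sum>i\<in>\<pi> ` {..<d}. (v $ i)\<^sup>2)"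
    using inj by (simp add: sum.reindex)
  also have "\<dots> \<le> (\<Sum>i<n. (v $ i)\<^sup>2)"
    using range by (intro sum_mono2) auto
  finally show "l2_norm_vec ((coord_mat \<pi> n d)\<^sup>T *\<^sub>v v) \<le> 1"
    using v le by (auto simp: transpose_coord_mat_mult_vec l2_norm_vec_eq)
qed

text \<open>The matrix times its pseudoinverse is the projection onto the coordinates in the range
  of \<open>\<pi>\<close>; the residual is \<open>- b\<close> on the others.\<close>

lemma residual_coord_mat:
  assumes b: "b \<in> carrier_vec n"
  shows "l2_norm_vec (coord_mat \<pi> n d *\<^sub>v (pinv (coord_mat \<pi> n d) *\<^sub>v b) - b)
    = sqrt (\<Sum>i\<in>{..<n} - \<pi> ` {..<d}. (b $ i)\<^sup>2)"
proof -
  let ?A = "coord_mat \<pi> n d"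
  let ?r = "?A *\<^sub>v (pinv ?A *\<^sub>v b) - b"
  have dim: "dim_vec ?r = n" using b by simp
  have "(?r $ i)\<^sup>2 = (if i \<in> \<pi> ` {..<d} then 0 else (b $ i)\<^sup>2)" if i: "i < n" for i
  proof -
    have "(?A *\<^sub>v (pinv ?A *\<^sub>v b)) $ i = (\<Sum>j<d. if i = \<pi> j then b $ \<pi> j else 0)"
      unfolding pinv_coord_mat transpose_coord_mat_mult_vec[OF b]
      using i by (simp add: coord_mat_def scalar_prod_def lessThan_atLeast0 of_bool_def if_distrib
          [of "\<lambda>x. x * _"] cong: if_cong)
    also have "\<dots> = (\<Sum>k\<in>\<pi> ` {..<d}. if i = k then b $ k else 0)"
      by (simp only: sum.reindex[OF inj] o_def)
    also have "\<dots> = (if i \<in> \<pi> ` {..<d} then b $ i else 0)"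
      by simp
    finally show ?thesis using b i by auto
  qed
  then have "(\<Sum>i<n. (?r $ i)\<^sup>2) = (\<Sum>i<n. if i \<in> \<pi> ` {..<d} then 0 else (b $ i)\<^sup>2)"
    by simp
  also have "\<dots> = (\<Sum>i\<in>{..<n} - \<pi> ` {..<d}. (b $ i)\<^sup>2)"
    by (simp add: sum.If_cases Diff_eq)
  finally show ?thesis by (simp only: l2_norm_vec_eq dim)
qed

end

section \<open>The hard instances and the counting argument\<close>

text \<open>Cutting the support down to \<open>k\<close> coordinates makes the residual adjustable:
  its square is \<open>k - d\<close> instead of \<open>n - d\<close>.\<close>

definition sign_vec :: "nat \<Rightarrow> nat \<Rightarrow> nat set \<Rightarrow> real vec" where
  "sign_vec n k U = vec n (\<lambda>i. if i < k then sign_in U i else 0)"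

lemma sign_vec_carrier [simp]: "sign_vec n k U \<in> carrier_vec n"
  by (simp add: sign_vec_def)

text \<open>The error in entry 0 is an affine sign sum with second moment \<open>s > 1 / 2\<close>.
  Its square exceeds \<open>s / 10 > 1 / 20\<close> for a quarter of the signs, whereas success
  keeps it at most \<open>\<kappa>\<^sup>2 * (k - d) \<le> 1 / 20\<close>.\<close>

lemma card_failing_signs:
  fixes S :: "real mat"
  assumes S: "S \<in> carrier_mat m n" and dk: "0 < d" "d \<le> k" "k \<le> n" and a: "a < k"
    and \<kappa>: "\<kappa> \<ge> 0" "\<kappa>\<^sup>2 * (real k - real d) \<le> 1 / 20"
    and far: "\<And>g. (\<Sum>i<k. ((\<Sum>l<m. g l * S $$ (l, i)) - of_bool (i = a))\<^sup>2) > 1 / 2"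
  defines "A \<equiv> coord_mat (transpose 0 a) n d"
  shows "2 ^ k \<le> 4 * real (card {U \<in> Pow {..<k}.
    \<not> linf_norm_vec (pinv (S * A) *\<^sub>v (S *\<^sub>v sign_vec n k U) - pinv A *\<^sub>v sign_vec n k U)
      \<le> \<kappa> * (spectral_norm (pinv A) * l2_norm_vec (A *\<^sub>v (pinv A *\<^sub>v sign_vec n k U) - sign_vec n k U))})"
    (is "_ \<le> 4 * real (card {U \<in> _. \<not> ?ok U})")
proof -
  \<comment> \<open>Swapping 0 and \<open>a\<close> puts the unit vector at \<open>a\<close> into
    column 0 and keeps the columns distinct.\<close>
  let ?\<pi> = "transpose 0 a"
  have inj: "inj_on ?\<pi> {..<d}"
    by (rule inj_on_subset[OF inj_transpose]) simp
  have im: "?\<pi> ` {..<d} \<subseteq> {..<k}"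
    using dk a by (auto simp: Transposition.transpose_def)
  then have range: "?\<pi> j < n" if "j < d" for j
    using that dk by fastforce
  have pinvA: "pinv A = A\<^sup>T"
    unfolding A_def by (rule pinv_coord_mat[OF inj range])
  from mult_mat_vec_first_affine[of m "pinv (S * A)"] obtain \<gamma> g
    where aff: "\<And>v. v \<in> carrier_vec m \<Longrightarrow> (pinv (S * A) *\<^sub>v v) $ 0 = \<gamma> + (\<Sum>l<m. g l * v $ l)"
    by blast
  define r where "r i = (\<Sum>l<m. g l * S $$ (l, i))" for i
  define w where "w i = r i - of_bool (i = a)" for i
  define s where "s = \<gamma>\<^sup>2 + (\<Sum>i<k. (w i)\<^sup>2)"
  have s: "s > 1 / 2"
    using far[of g] zero_le_power2[of \<gamma>] unfolding s_def w_def r_def by linarith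
  have ok: "(\<gamma> + (\<Sum>i<k. w i * sign_in U i))\<^sup>2 \<le> 1 / 20" if ok: "?ok U" for U
  proof -
    let ?b = "sign_vec n k U"
    have "(S *\<^sub>v ?b) $ l = (\<Sum>i<k. S $$ (l, i) * sign_in U i)" if "l < m" for l
    proof -
      have "(S *\<^sub>v ?b) $ l = (\<Sum>i<n. if i < k then S $$ (l, i) * sign_in U i else 0)"
        using that S by (auto simp: scalar_prod_def sign_vec_def lessThan_atLeast0 intro!: sum.cong)
      also have "\<dots> = (\<Sum>i\<in>{..<n} \<inter> {i. i < k}. S $$ (l, i) * sign_in U i)"
        by (simp add: sum.If_cases)
      also have "{..<n} \<inter> {i. i < k} = {..<k}"
        using dk by auto
      finally show ?thesis .
    qed
    then have "(\<Sum>l<m. g l * (S *\<^sub>v ?b) $ l) = (\<Sum>l<m. \<Sum>i<k. g l * S $$ (l, i) * sign_in U i)"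
      by (simp add: sum_distrib_left mult.assoc)
    also have "\<dots> = (\<Sum>i<k. r i * sign_in U i)"
      by (subst sum.swap) (simp add: r_def sum_distrib_right)
    finally have x': "(pinv (S * A) *\<^sub>v (S *\<^sub>v ?b)) $ 0 = \<gamma> + (\<Sum>i<k. r i * sign_in U i)"
      using S by (subst aff) auto
    have "pinv A *\<^sub>v ?b = vec d (\<lambda>j. ?b $ ?\<pi> j)"
      unfolding pinvA unfolding A_def by (rule transpose_coord_mat_mult_vec[OF inj range]) auto
    then have xs: "(pinv A *\<^sub>v ?b) $ 0 = sign_in U a" and dim: "dim_vec (pinv A *\<^sub>v ?b) = d"
      using dk a by (simp_all add: sign_vec_def)
    have "\<gamma> + (\<Sum>i<k. w i * sign_in U i) = \<gamma> + (\<Sum>i<k. r i * sign_in U i) - sign_in U a"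
      using a by (simp add: w_def left_diff_distrib sum_subtractf of_bool_def if_distrib
          [of "\<lambda>x. x * _"] cong: if_cong)
    also have "\<dots> = (pinv (S * A) *\<^sub>v (S *\<^sub>v ?b) - pinv A *\<^sub>v ?b) $ 0"
      using dim dk by (simp add: x' xs)
    also have "\<bar>\<dots>\<bar> \<le> linf_norm_vec (pinv (S * A) *\<^sub>v (S *\<^sub>v ?b) - pinv A *\<^sub>v ?b)"
      using dim dk by (intro abs_index_le_linf_norm_vec) simp
    also have "\<dots> \<le> \<kappa> * (spectral_norm (pinv A) * l2_norm_vec (A *\<^sub>v (pinv A *\<^sub>v ?b) - ?b))"
      using ok .
    also have "\<dots> \<le> \<kappa> * (1 * l2_norm_vec (A *\<^sub>v (pinv A *\<^sub>v ?b) - ?b))"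
      unfolding A_def using \<kappa> spectral_norm_pinv_coord_mat[OF inj range]
      by (intro mult_left_mono mult_right_mono) (auto simp: l2_norm_vec_eq intro: sum_nonneg)
    also have "l2_norm_vec (A *\<^sub>v (pinv A *\<^sub>v ?b) - ?b) = sqrt (real k - real d)"
    proof -
      have "(\<Sum>i\<in>{..<n} - ?\<pi> ` {..<d}. (?b $ i)\<^sup>2) = (\<Sum>i\<in>{..<k} - ?\<pi> ` {..<d}. 1)"
        using dk by (intro sum.mono_neutral_cong_right) (auto simp: sign_vec_def sign_in_def)
      also have "\<dots> = real k - real d"
        using im inj dk by (simp add: card_Diff_subset card_image of_nat_diff)
      finally show ?thesis
        unfolding A_def by (simp add: residual_coord_mat[OF inj range])
    qed
    finally have "\<bar>\<gamma> + (\<Sum>i<k. w i * sign_in U i)\<bar> \<le> \<kappa> * sqrt (real k - real d)"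
      by simp
    then have "(\<gamma> + (\<Sum>i<k. w i * sign_in U i))\<^sup>2 \<le> (\<kappa> * sqrt (real k - real d))\<^sup>2"
      by (metis abs_ge_zero power2_abs power_mono)
    with \<kappa> dk show ?thesis
      by (simp add: power_mult_distrib)
  qed
  have "2 ^ card {..<k} \<le> 4 * real (card {U \<in> Pow {..<k}. (\<gamma> + (\<Sum>i<k. w i * sign_in U i))\<^sup>2 > s / 10})"
    by (rule sign_sum_anticoncentration) (use s s_def in auto)
  also have "\<dots> \<le> 4 * real (card {U \<in> Pow {..<k}. \<not> ?ok U})"
    using ok s by (intro mult_left_mono of_nat_mono card_mono) fastforce+
  finally show ?thesis by simp
qed

text \<open>Some \<open>S\<close> fails on at most a tenth of the pairs \<open>(a, U)\<close>. Each
  \<open>a\<close> far from its row space accounts for at least \<open>2 ^ k / 4\<close> failures,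
  so at most \<open>4 / 10 * k\<close> indices are far. The other \<open>6 / 10 * k\<close> lie
  within squared distance 1/2, which costs half a dimension each.\<close>

lemma sketch_dim_lower_bound:
  fixes P :: "real mat measure"
  assumes P: "mat_distribution m n P" and dk: "0 < d" "d \<le> k" "k \<le> n"
    and \<kappa>: "\<kappa> \<ge> 0" "\<kappa>\<^sup>2 * (real k - real d) \<le> 1 / 20"
    and succ: "\<And>A b. A \<in> carrier_mat n d \<Longrightarrow> b \<in> carrier_vec n \<Longrightarrow>
       \<P>(S in P. linf_norm_vec (pinv (S * A) *\<^sub>v (S *\<^sub>v b) - pinv A *\<^sub>v b)
          \<le> \<kappa> * (spectral_norm (pinv A) * l2_norm_vec (A *\<^sub>v (pinv A *\<^sub>v b) - b))) \<ge> 9 / 10"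
  shows "3 / 10 * real k \<le> m"
proof -
  interpret prob_space P
    using P by (simp add: mat_distribution_def)
  have space: "space P = carrier_mat m n"
    using P sets_eq_imp_space_eq[of P "borel_mat m n"]
    by (simp add: mat_distribution_def borel_mat_def)
  define ok where "ok S a U \<longleftrightarrow> (let A = coord_mat (transpose 0 a) n d; b = sign_vec n k U in
      linf_norm_vec (pinv (S * A) *\<^sub>v (S *\<^sub>v b) - pinv A *\<^sub>v b)
        \<le> \<kappa> * (spectral_norm (pinv A) * l2_norm_vec (A *\<^sub>v (pinv A *\<^sub>v b) - b)))" for S a U
  let ?I = "{..<k} \<times> Pow {..<k}"
  have "\<exists>S\<in>space P. 9 / 10 * card ?I \<le> card {i \<in> ?I. S \<in> {S \<in> space P. case i of (a, U) \<Rightarrow> ok S a U}}"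
    by (rule exists_point_in_many_events) (use succ in \<open>auto simp: ok_def Let_def\<close>)
  then obtain S where S: "S \<in> space P"
    and many: "9 / 10 * real (card ?I) \<le> card {i \<in> ?I. case i of (a, U) \<Rightarrow> ok S a U}"
    by auto
  have card_diff: "real (card (?I - {i \<in> ?I. case i of (a, U) \<Rightarrow> ok S a U}))
      = real (card ?I) - card {i \<in> ?I. case i of (a, U) \<Rightarrow> ok S a U}" (is "real (card (_ - ?G)) = _")
  proof -
    have "?G \<subseteq> ?I" "finite ?I" by auto
    then show ?thesis
      by (simp only: card_Diff_subset[OF finite_subset] of_nat_diff[OF card_mono])
  qed
  define J where "J = {a \<in> {..<k}. \<exists>g. (\<Sum>i<k. ((\<Sum>l<m. g l * S $$ (l, i)) - of_bool (i = a))\<^sup>2) \<le> 1 / 2}"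
  have J: "J \<subseteq> {..<k}" by (auto simp: J_def)
  \<comment> \<open>Double counting of the failing pairs, grouped by \<open>a\<close>.\<close>
  have "(\<Sum>a\<in>{..<k} - J. 2 ^ k) \<le> (\<Sum>a\<in>{..<k} - J. 4 * real (card {U \<in> Pow {..<k}. \<not> ok S a U}))"
  proof (rule sum_mono)
    fix a assume "a \<in> {..<k} - J"
    then have "a < k"
      and "\<And>g. (\<Sum>i<k. ((\<Sum>l<m. g l * S $$ (l, i)) - of_bool (i = a))\<^sup>2) > 1 / 2"
      by (auto simp: J_def not_le)
    from card_failing_signs[OF _ dk this(1) \<kappa> this(2)] S
    show "2 ^ k \<le> 4 * real (card {U \<in> Pow {..<k}. \<not> ok S a U})"
      by (simp add: ok_def Let_def space)
  qed
  also have "\<dots> \<le> (\<Sum>a<k. 4 * real (card {U \<in> Pow {..<k}. \<not> ok S a U}))"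
    by (intro sum_mono2) auto
  also have "\<dots> = 4 * real (card (SIGMA a:{..<k}. {U \<in> Pow {..<k}. \<not> ok S a U}))"
    by (simp add: sum_distrib_left)
  also have "(SIGMA a:{..<k}. {U \<in> Pow {..<k}. \<not> ok S a U}) = ?I - {i \<in> ?I. case i of (a, U) \<Rightarrow> ok S a U}"
    by auto
  also have "real (card \<dots>) = real (card ?I) - card {i \<in> ?I. case i of (a, U) \<Rightarrow> ok S a U}"
    by (rule card_diff)
  also have "4 * \<dots> \<le> 4 / 10 * card ?I"
    using many by simp
  also have "\<dots> = 4 / 10 * real k * 2 ^ k"
    by (simp add: card_cartesian_product card_Pow)
  finally have "real (card ({..<k} - J)) * 2 ^ k \<le> 4 / 10 * real k * 2 ^ k"
    by simp
  then have "real (card ({..<k} - J)) \<le> 4 / 10 * real k"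
    by (subst (asm) mult_le_cancel_right_pos) auto
  moreover have "real (card ({..<k} - J)) = real k - card J"
    using J card_mono[OF _ J] by (simp add: card_Diff_subset finite_subset of_nat_diff)
  ultimately have "6 / 10 * real k \<le> card J" by simp
  moreover have "(1 - 1 / 2) * real (card J) \<le> m"
    using J by (intro card_unit_vectors_near_span[where s = "\<lambda>l i. S $$ (l, i)"]) (auto simp: J_def)
  ultimately show ?thesis by simp
qed

section \<open>Choice of the support size and the final constant\<close>

theorem corollary18:
  fixes C :: real
  assumes "C > 0"
  shows "\<exists>c>0. \<forall>(\<epsilon>::real) (m::nat) (n::nat) (d::nat) (P::real mat measure).
    0 < \<epsilon> \<and> \<epsilon> < 1 \<and> d \<le> n \<and> mat_distribution m n P \<and>
    (\<forall>A\<in>carrier_mat n d. \<forall>b\<in>carrier_vec n.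
       \<P>(S in P.
           linf_norm_vec (pinv (S * A) *\<^sub>v (S *\<^sub>v b) - pinv A *\<^sub>v b)
             \<le> C * (\<epsilon> / sqrt (real d) * spectral_norm (pinv A)
                      * l2_norm_vec (A *\<^sub>v (pinv A *\<^sub>v b) - b)))
         \<ge> 9 / 10)
    \<longrightarrow> real m \<ge> c * min (real n) (real d / \<epsilon>\<^sup>2)"
\<comment> \<open>The constant combines \<open>m \<ge> 3 / 10 * k\<close> with \<open>min n (d /
  \<epsilon>\<^sup>2) \<le> (1 + 40 * C\<^sup>2) * k\<close>.\<close>
proof (intro exI[of _ "3 / (10 * (1 + 40 * C\<^sup>2))"] conjI allI impI)
  have D: "0 < 1 + 40 * C\<^sup>2" by (rule add_pos_nonneg) auto
  then show "0 < 3 / (10 * (1 + 40 * C\<^sup>2))" by simp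
  fix \<epsilon> :: real and m n d :: nat and P :: "real mat measure"
  assume "0 < \<epsilon> \<and> \<epsilon> < 1 \<and> d \<le> n \<and> mat_distribution m n P \<and>
    (\<forall>A\<in>carrier_mat n d. \<forall>b\<in>carrier_vec n.
       \<P>(S in P.
           linf_norm_vec (pinv (S * A) *\<^sub>v (S *\<^sub>v b) - pinv A *\<^sub>v b)
             \<le> C * (\<epsilon> / sqrt (real d) * spectral_norm (pinv A)
                      * l2_norm_vec (A *\<^sub>v (pinv A *\<^sub>v b) - b)))
         \<ge> 9 / 10)"
  then have \<epsilon>: "0 < \<epsilon>" and dn: "d \<le> n" and P: "mat_distribution m n P"
    and succ: "\<And>A b. A \<in> carrier_mat n d \<Longrightarrow> b \<in> carrier_vec n \<Longrightarrow>
       \<P>(S in P. linf_norm_vec (pinv (S * A) *\<^sub>v (S *\<^sub>v b) - pinv A *\<^sub>v b)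
          \<le> C * \<epsilon> / sqrt d * (spectral_norm (pinv A) * l2_norm_vec (A *\<^sub>v (pinv A *\<^sub>v b) - b))) \<ge> 9 / 10"
    by (auto simp: mult.assoc)
  show "real m \<ge> 3 / (10 * (1 + 40 * C\<^sup>2)) * min (real n) (real d / \<epsilon>\<^sup>2)"
  proof (cases "d = 0")
    case False
    then have d: "d > 0" by simp
    \<comment> \<open>This is the largest excess \<open>k - d\<close> allowed: with
      \<open>\<kappa> = C * \<epsilon> / sqrt d\<close>, it solves
      \<open>\<kappa>\<^sup>2 * x = 1 / 20\<close>.\<close>
    define x where "x = real d / (20 * C\<^sup>2 * \<epsilon>\<^sup>2)"
    \<comment> \<open>The maximum with \<open>d\<close> covers \<open>x < d\<close>: for \<open>k = d\<close> the residual vanishes.\<close>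
    define k where "k = max d (min n (nat \<lfloor>x\<rfloor>))"
    have x: "x > 0" using d \<epsilon> assms by (simp add: x_def)
    have dk: "d \<le> k" "k \<le> n" using dn by (auto simp: k_def)
    have "real k - real d \<le> x"
      using x by (auto simp: k_def max_def min_def) linarith+
    then have "(C * \<epsilon> / sqrt d)\<^sup>2 * (real k - real d) \<le> (C * \<epsilon> / sqrt d)\<^sup>2 * x"
      by (intro mult_left_mono) auto
    also have "\<dots> = 1 / 20"
      using d \<epsilon> assms by (simp add: x_def power_divide power_mult_distrib)
    finally have m: "3 / 10 * real k \<le> m"
      using \<epsilon> assms by (intro sketch_dim_lower_bound[OF P d dk _ _ succ]) auto
    have "min (real n) (real d / \<epsilon>\<^sup>2) \<le> (1 + 40 * C\<^sup>2) * k"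
    proof (cases "n \<le> k")
      case True
      then have "real n \<le> 1 * real k" by simp
      also have "\<dots> \<le> (1 + 40 * C\<^sup>2) * k" by (intro mult_right_mono) auto
      finally show ?thesis by simp
    next
      case False
      then have "nat \<lfloor>x\<rfloor> \<le> k" by (auto simp: k_def)
      \<comment> \<open>Rounding down loses less than 1, which \<open>k \<ge> d \<ge> 1\<close>
        absorbs into the factor 2.\<close>
      with d dk have "x \<le> 2 * real k" by linarith
      then have "20 * C\<^sup>2 * x \<le> 20 * C\<^sup>2 * (2 * real k)"
        by (intro mult_left_mono) auto
      moreover have "real d / \<epsilon>\<^sup>2 = 20 * C\<^sup>2 * x"
        using assms by (simp add: x_def)
      ultimately show ?thesis by (simp add: algebra_simps)
    qed
    then have "min (real n) (real d / \<epsilon>\<^sup>2) * 3 \<le> (1 + 40 * C\<^sup>2) * (3 * k)" by simp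
    also have "\<dots> \<le> (1 + 40 * C\<^sup>2) * (10 * m)"
      using m D by (intro mult_left_mono) auto
    finally show ?thesis using D by (simp add: divide_le_eq ac_simps)
  \<comment> \<open>For \<open>d = 0\<close> the minimum is 0.\<close>
  qed simp
qed

end
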